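(* Let $G=(V,E,w)$ be a finite, undirected, connected graph with positive edge weights, let $s_1,s_2\in V$ be two distinct seeds and $q\in V\setminus\{s_1,s_2\}$ a query node. Then the Probabilistic Watershed probability satisfies $$P(q\sim s_1)=\frac{w(\mathcal{F}_{s_2}^{q})+w(\mathcal{F}_{s_1}^{s_2})-w(\mathcal{F}_{s_1}^{q})}{2\,w(\mathcal{F}_{s_1}^{s_2})}.$$
   Context: The weight of a forest is the product of the weights of its edges, and the weight of a set of forests is the sum of their weights. For $u,v\in V$, $\mathcal{F}_u^v$ is the set of spanning forests of $G$ with exactly two trees in which $u$ and $v$ lie in different trees. For a third node $q$, $\mathcal{F}_{u,q}^{v}:=\mathcal{F}_u^v\cap\mathcal{F}_q^v$ is the set of such 2-forests in which $u$ and $q$ lie in one tree and $v$ in the other. The Probabilistic Watershed probability is $P(q\sim s_1):=w(\mathcal{F}_{s_1,q}^{s_2})/w(\mathcal{F}_{s_1}^{s_2})$, i.e. the probability of sampling a 2-forest connecting $q$ to $s_1$ under the Gibbs distribution $P(f)=w(f)/\sum_{f'\in\mathcal{F}_{s_1}^{s_2}}w(f')$ on $\mathcal{F}_{s_1}^{s_2}$ (with $w(e)=\exp(-\mu c(e))$ for edge costs $c$ and $\mu\ge 0$). *)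

theory Defs
  imports Complex_Main
begin

text \<open>
  Finite simple undirected graphs with vertex set \<open>V\<close> and edge set \<open>E\<close>, an edge being a
  two-element set of vertices.
\<close>

definition finite_graph :: "'a set \<Rightarrow> 'a set set \<Rightarrow> bool" where
  "finite_graph V E \<longleftrightarrow> finite V \<and> (\<forall>e\<in>E. e \<subseteq> V \<and> card e = 2)"

definition walk :: "'a set \<Rightarrow> 'a set set \<Rightarrow> 'a list \<Rightarrow> bool" where
  "walk V E xs \<longleftrightarrow> xs \<noteq> [] \<and> set xs \<subseteq> V \<and> successively (\<lambda>x y. {x, y} \<in> E) xs"

definition joined :: "'a set \<Rightarrow> 'a set set \<Rightarrow> 'a \<Rightarrow> 'a \<Rightarrow> bool" where
  "joined V E u v \<longleftrightarrow> (\<exists>xs. walk V E xs \<and> hd xs = u \<and> last xs = v)"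

definition connected_graph :: "'a set \<Rightarrow> 'a set set \<Rightarrow> bool" where
  "connected_graph V E \<longleftrightarrow> V \<noteq> {} \<and> (\<forall>u\<in>V. \<forall>v\<in>V. joined V E u v)"

definition graph_components :: "'a set \<Rightarrow> 'a set set \<Rightarrow> 'a set set" where
  "graph_components V E = V // {(u, v). joined V E u v}"

text \<open>A cycle is listed without repeating its first vertex at the end.\<close>

definition graph_cycle :: "'a set \<Rightarrow> 'a set set \<Rightarrow> 'a list \<Rightarrow> bool" where
  "graph_cycle V E xs \<longleftrightarrow>
     walk V E xs \<and> distinct xs \<and> 3 \<le> length xs \<and> {last xs, hd xs} \<in> E"

text \<open>
  A spanning forest contains all of \<open>V\<close> and is identified with its edge set; its trees are its
  connected components, isolated vertices included.
\<close>

definition spanning_forest :: "'a set \<Rightarrow> 'a set set \<Rightarrow> 'a set set \<Rightarrow> bool" where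
  "spanning_forest V E f \<longleftrightarrow> f \<subseteq> E \<and> (\<nexists>xs. graph_cycle V f xs)"

text \<open>\<open>two_forests V E u v\<close> is $\mathcal{F}_u^v$.\<close>

definition two_forests :: "'a set \<Rightarrow> 'a set set \<Rightarrow> 'a \<Rightarrow> 'a \<Rightarrow> 'a set set set" where
  "two_forests V E u v =
     {f. spanning_forest V E f \<and> card (graph_components V f) = 2 \<and> \<not> joined V f u v}"

text \<open>\<open>two_forests_joining V E u q v\<close> is $\mathcal{F}_{u,q}^v$.\<close>

definition two_forests_joining ::
    "'a set \<Rightarrow> 'a set set \<Rightarrow> 'a \<Rightarrow> 'a \<Rightarrow> 'a \<Rightarrow> 'a set set set" where
  "two_forests_joining V E u q v = two_forests V E u v \<inter> two_forests V E q v"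

definition forest_weight :: "('a set \<Rightarrow> real) \<Rightarrow> 'a set set \<Rightarrow> real" where
  "forest_weight w f = (\<Prod>e\<in>f. w e)"

definition forests_weight :: "('a set \<Rightarrow> real) \<Rightarrow> 'a set set set \<Rightarrow> real" where
  "forests_weight w \<F> = (\<Sum>f\<in>\<F>. forest_weight w f)"

text \<open>\<open>watershed_prob V E w s1 s2 q\<close> is $P(q \sim s_1)$ for the seeds $s_1$, $s_2$.\<close>

definition watershed_prob ::
    "'a set \<Rightarrow> 'a set set \<Rightarrow> ('a set \<Rightarrow> real) \<Rightarrow> 'a \<Rightarrow> 'a \<Rightarrow> 'a \<Rightarrow> real" where
  "watershed_prob V E w s1 s2 q =
     forests_weight w (two_forests_joining V E s1 q s2) / forests_weight w (two_forests V E s1 s2)"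

end

theory Submission
  imports Defs
begin

text \<open>
  A forest with two trees cannot separate the three nodes pairwise, so exactly one of
  \<open>s1\<close>, \<open>s2\<close>, \<open>q\<close> is alone in its tree unless all three lie together. With \<open>A\<close>, \<open>B\<close>, \<open>C\<close> the weights
  of the forests that isolate \<open>s2\<close>, \<open>s1\<close>, \<open>q\<close> respectively, the weights of the sets
  $\mathcal{F}_{s_2}^{q}$, $\mathcal{F}_{s_1}^{s_2}$, $\mathcal{F}_{s_1}^{q}$ are \<open>A + C\<close>, \<open>A + B\<close>,
  \<open>B + C\<close>, and \<open>A\<close> is recovered from these three sums.
\<close>

lemma joined_in_vertices:
  assumes "joined V E u v"
  shows "u \<in> V" and "v \<in> V"
  using assms unfolding joined_def walk_def by (auto simp: subset_iff)

lemma joined_refl: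
  assumes "u \<in> V"
  shows "joined V E u u"
  unfolding joined_def walk_def using assms by (intro exI[of _ "[u]"]) simp

lemma joined_sym:
  assumes "joined V E u v"
  shows "joined V E v u"
proof -
  obtain xs where xs: "walk V E xs" "hd xs = u" "last xs = v"
    using assms unfolding joined_def by blast
  then have "walk V E (rev xs)"
    by (simp add: walk_def successively_rev insert_commute)
  then show ?thesis
    unfolding joined_def using xs
    by (intro exI[of _ "rev xs"]) (simp add: walk_def hd_rev last_rev)
qed

lemma joined_trans:
  assumes "joined V E u v" and "joined V E v x"
  shows "joined V E u x"
proof -
  obtain xs where xs: "walk V E xs" "hd xs = u" "last xs = v"
    using assms(1) unfolding joined_def by blast
  obtain ys where ys: "walk V E ys" "hd ys = v" "last ys = x"
    using assms(2) unfolding joined_def by blast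
  \<comment> \<open>The shared vertex \<open>v\<close> is dropped from the second walk:
    \<open>xs @ ys\<close> would list it twice in a row and so require \<open>{v, v}\<close> as an
    edge.\<close>
  obtain zs where zs: "ys = v # zs"
    using ys by (cases ys) (auto simp: walk_def)
  have "walk V E (xs @ zs)"
    using xs ys unfolding zs walk_def
    by (cases zs) (auto simp: successively_append_iff)
  moreover have "hd (xs @ zs) = u" "last (xs @ zs) = x"
    using xs ys unfolding zs walk_def by (auto split: if_splits)
  ultimately show ?thesis
    unfolding joined_def by blast
qed

lemma equiv_joined: "equiv V {(u, v). joined V E u v}"
  by (rule equivI)
    (auto simp: refl_on_def sym_def trans_def
      intro: joined_refl joined_sym joined_trans dest: joined_in_vertices)

text \<open>Pigeonhole: three pairwise unjoined nodes would lie in three distinct classes, but there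
  are only two.\<close>

lemma two_components_join:
  assumes "card (graph_components V f) = 2"
    and "a \<in> V" and "b \<in> V" and "c \<in> V"
  shows "joined V f a b \<or> joined V f b c \<or> joined V f a c"
proof (rule ccontr)
  assume sep: "\<not> ?thesis"
  define R where "R = {(u, v). joined V f u v}"
  have eq: "R `` {x} = R `` {y} \<longleftrightarrow> joined V f x y" if "x \<in> V" "y \<in> V" for x y
    using eq_equiv_class_iff[OF equiv_joined[of V f] that] by (simp add: R_def)
  have "card {R `` {a}, R `` {b}, R `` {c}} = 3"
    using sep assms(2-4) by (simp add: eq)
  moreover have "{R `` {a}, R `` {b}, R `` {c}} \<subseteq> graph_components V f"
    unfolding graph_components_def R_def[symmetric] using assms(2-4) by (simp add: quotientI)
  \<comment> \<open>An infinite set has \<open>card\<close> 0, so the value 2 already forces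
    finiteness.\<close>
  moreover have "finite (graph_components V f)"
    using assms(1) by (intro card_ge_0_finite) simp
  ultimately show False
    using card_mono[of "graph_components V f" "{R `` {a}, R `` {b}, R `` {c}}"] assms(1) by linarith
qed

lemma finite_spanning_forests:
  assumes "finite_graph V E"
  shows "finite {f. spanning_forest V E f}"
proof -
  have "E \<subseteq> Pow V" "finite V"
    using assms unfolding finite_graph_def by auto
  then have "finite (Pow E)"
    by (meson finite_Pow_iff finite_subset)
  then show ?thesis
    by (rule rev_finite_subset) (auto simp: spanning_forest_def)
qed

text \<open>The identity holds forest by forest, once all four weights are written as sums over the
  common index set \<open>T\<close>.\<close>

lemma weight_two_forests_joining:
  fixes w :: "'a set \<Rightarrow> real"
  assumes "finite_graph V E" and "a \<in> V" and "b \<in> V" and "q \<in> V"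
  shows "2 * forests_weight w (two_forests_joining V E a q b) =
    forests_weight w (two_forests V E b q) + forests_weight w (two_forests V E a b)
      - forests_weight w (two_forests V E a q)"
proof -
  define T where "T = {f. spanning_forest V E f \<and> card (graph_components V f) = 2}"
  have fin: "finite T"
    using finite_spanning_forests[OF assms(1)] by (rule rev_finite_subset) (auto simp: T_def)
  have weight: "forests_weight w {f \<in> T. P f} = (\<Sum>f\<in>T. if P f then forest_weight w f else 0)" for P
    unfolding forests_weight_def using fin by (rule sum.inter_filter)
  have separating: "two_forests V E u v = {f \<in> T. \<not> joined V f u v}" for u v
    by (auto simp: two_forests_def T_def)
  have joining: "two_forests_joining V E a q b = {f \<in> T. \<not> joined V f a b \<and> \<not> joined V f q b}"
    unfolding two_forests_joining_def separating by blast
  \<comment> \<open>Among \<open>a\<close>, \<open>b\<close>, \<open>q\<close> either all pairs are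
    joined or exactly one is. The coefficients of \<open>forest_weight w f\<close> then read 0 = 0 +
    0 - 0 for all pairs, 2 = 1 + 1 - 0 for \<open>a\<close>, \<open>q\<close> alone, 0 = 1 + 0 - 1
    for \<open>a\<close>, \<open>b\<close> alone and 0 = 0 + 1 - 1 for \<open>b\<close>,
    \<open>q\<close> alone.\<close>
  have "2 * (if \<not> joined V f a b \<and> \<not> joined V f q b then forest_weight w f else 0) =
      (if \<not> joined V f b q then forest_weight w f else 0)
      + (if \<not> joined V f a b then forest_weight w f else 0)
      - (if \<not> joined V f a q then forest_weight w f else 0)" if "f \<in> T" for f
  proof -
    have "joined V f a b \<or> joined V f b q \<or> joined V f a q"
      using that assms(2-4) by (intro two_components_join) (auto simp: T_def)
    moreover have "joined V f q b \<longleftrightarrow> joined V f b q"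
      by (blast intro: joined_sym)
    moreover have "joined V f a b \<Longrightarrow> joined V f b q \<longleftrightarrow> joined V f a q"
      "joined V f b q \<Longrightarrow> joined V f a q \<Longrightarrow> joined V f a b"
      by (meson joined_sym joined_trans)+
    ultimately show ?thesis
      by auto
  qed
  then show ?thesis
    unfolding joining separating weight sum_distrib_left
    by (simp only: sum.distrib[symmetric] sum_subtractf[symmetric] cong: sum.cong)
qed

theorem theorem3p2:
  fixes V :: "'a set" and E :: "'a set set" and w :: "'a set \<Rightarrow> real" and s1 s2 q :: 'a
  assumes "finite_graph V E"
    and "connected_graph V E"
    and "\<And>e. e \<in> E \<Longrightarrow> w e > 0"
    and "s1 \<in> V" and "s2 \<in> V" and "s1 \<noteq> s2"
    and "q \<in> V - {s1, s2}"
  shows "watershed_prob V E w s1 s2 q =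
    (forests_weight w (two_forests V E s2 q) + forests_weight w (two_forests V E s1 s2)
       - forests_weight w (two_forests V E s1 q))
    / (2 * forests_weight w (two_forests V E s1 s2))"
proof -
  have "q \<in> V"
    using assms(7) by simp
  \<comment> \<open>Read from right to left, the identity turns the numerator into twice the joining
    weight, and the factor 2 cancels.\<close>
  from weight_two_forests_joining[OF assms(1,4,5) this, of w, symmetric] show ?thesis
    by (simp add: watershed_prob_def)
qed

end
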